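(* Let $G=(V,E)$ be a finite simple graph with node weights $w\in\mathbb{R}^V_+$ and edge weights satisfying $w_{ij}\ge\min\{w_i,w_j\}$ for all edges $ij\in E$. Then $p_{\mathrm{han}}^{(2)}(G,w)=\rho_2(G,w)$.
   Context: Let $V=[n]$. For $I\subseteq V$ write $x^I=\prod_{i\in I}x_i$ and $(1-x)^I=\prod_{i\in I}(1-x_i)$. For an integer $t\ge 1$, $$H_t=\Big\{\sum_{T\subseteq V,\ |T|\le t}\ \sum_{I\subseteq T}c_{T,I}\,x^I(1-x)^{T\setminus I}:\ c_{T,I}\ge 0\Big\}\subseteq\mathbb{R}[x_1,\dots,x_n].$$ Set $p_{G,w}=\sum_{i\in V}w_ix_i-\sum_{ij\in E}w_{ij}x_ix_j$ and $p_{\mathrm{han}}^{(t)}(G,w)=\inf\{\lambda\in\mathbb{R}:\lambda-p_{G,w}\in H_t\}$ (the Handelman bound of order $t$). For an integer $t\ge1$, the fractional $t$-clique cover number is $$\rho_t(G,w)=\min\Big\{\sum_C\lambda_C:\ \sum_C\lambda_C\chi^C=w,\ \lambda_C\ge 0\Big\},$$ where $C$ ranges over the cliques of $G$ (sets of pairwise adjacent nodes, including single nodes) with $|C|\le t$ and $\chi^C\in\{0,1\}^V$ is the characteristic vector of $C$. *)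

theory Defs
  imports Complex_Main "HOL-Library.Poly_Mapping" "HOL-Library.Extended_Real"
    "HOL-Library.Indicator_Function"
begin

text \<open>Real polynomials in commuting variables indexed by \<^typ>\<open>'a\<close>: finitely supported maps
  from monomials (exponent vectors) to coefficients.\<close>

type_synonym 'a rpoly = "('a \<Rightarrow>\<^sub>0 nat) \<Rightarrow>\<^sub>0 real"

definition PConst :: "real \<Rightarrow> 'a rpoly" where
  "PConst c = Poly_Mapping.single 0 c"

definition PVar :: "'a \<Rightarrow> 'a rpoly" where
  "PVar i = Poly_Mapping.single (Poly_Mapping.single i 1) 1"

definition simple_graph :: "'a set \<Rightarrow> 'a set set \<Rightarrow> bool" where
  "simple_graph V E \<longleftrightarrow> finite V \<and> (\<forall>e\<in>E. e \<subseteq> V \<and> card e = 2)"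

definition clique :: "'a set \<Rightarrow> 'a set set \<Rightarrow> 'a set \<Rightarrow> bool" where
  "clique V E C \<longleftrightarrow> C \<subseteq> V \<and> (\<forall>i\<in>C. \<forall>j\<in>C. i \<noteq> j \<longrightarrow> {i, j} \<in> E)"

definition handelman_set :: "'a set \<Rightarrow> nat \<Rightarrow> 'a rpoly set" where
  "handelman_set V t =
     {\<Sum>T\<in>{T. T \<subseteq> V \<and> card T \<le> t}. \<Sum>I\<in>Pow T.
        PConst (c T I) * (\<Prod>i\<in>I. PVar i) * (\<Prod>i\<in>T - I. 1 - PVar i)
      | c :: 'a set \<Rightarrow> 'a set \<Rightarrow> real. \<forall>T I. 0 \<le> c T I}"

definition graph_poly :: "'a set \<Rightarrow> 'a set set \<Rightarrow> ('a \<Rightarrow> real) \<Rightarrow> ('a set \<Rightarrow> real) \<Rightarrow> 'a rpoly" where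
  "graph_poly V E w wE =
     (\<Sum>i\<in>V. PConst (w i) * PVar i) - (\<Sum>e\<in>E. PConst (wE e) * (\<Prod>i\<in>e. PVar i))"

text \<open>The infimum is taken in the extended reals, so that it is \<open>\<infinity>\<close> if no \<open>r\<close> is feasible and
  \<open>-\<infinity>\<close> if the feasible \<open>r\<close> are unbounded below.\<close>

definition handelman_bound ::
  "'a set \<Rightarrow> 'a set set \<Rightarrow> ('a \<Rightarrow> real) \<Rightarrow> ('a set \<Rightarrow> real) \<Rightarrow> nat \<Rightarrow> ereal" where
  "handelman_bound V E w wE t =
     Inf {ereal r | r. PConst r - graph_poly V E w wE \<in> handelman_set V t}"

definition bounded_cliques :: "'a set \<Rightarrow> 'a set set \<Rightarrow> nat \<Rightarrow> 'a set set" where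
  "bounded_cliques V E t = {C. clique V E C \<and> card C \<le> t}"

definition fractional_clique_cover ::
  "'a set \<Rightarrow> 'a set set \<Rightarrow> ('a \<Rightarrow> real) \<Rightarrow> nat \<Rightarrow> ('a set \<Rightarrow> real) \<Rightarrow> bool" where
  "fractional_clique_cover V E w t l \<longleftrightarrow>
     (\<forall>C\<in>bounded_cliques V E t. 0 \<le> l C) \<and>
     (\<forall>i\<in>V. (\<Sum>C\<in>bounded_cliques V E t. l C * indicator C i) = w i)"

text \<open>A genuine minimum rather than an infimum: the value is specified only if the optimum is
  attained. The empty clique is admitted; it covers nothing and does not affect the minimum.\<close>

definition fractional_clique_cover_number ::
  "'a set \<Rightarrow> 'a set set \<Rightarrow> ('a \<Rightarrow> real) \<Rightarrow> nat \<Rightarrow> real" where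
  "fractional_clique_cover_number V E w t =
     (LEAST s. \<exists>l. fractional_clique_cover V E w t l \<and> s = (\<Sum>C\<in>bounded_cliques V E t. l C))"

end

theory Submission
  imports Defs "HOL-Analysis.Function_Topology"
begin

text \<open>From a fractional cover \<open>l\<close> by cliques of size at most two, the form
  \<open>\<Sum>\<^sub>C l\<^sub>C (1-x)\<^sup>C + \<Sum>\<^sub>e (w\<^sub>e - l\<^sub>e) x\<^sup>e\<close> is a Handelman representation of
  \<open>\<Sum>\<^sub>C l\<^sub>C - p\<close>, since \<open>l\<^sub>e \<le> min {w\<^sub>i, w\<^sub>j} \<le> w\<^sub>e\<close> for \<open>e = {i, j}\<close>.
  Conversely, evaluate a representation of \<open>r - p\<close> at 0/1 vectors with at most two ones. This gives
  \<open>r = \<Sum>\<^sub>T c\<^sub>T\<^sub>,\<^sub>\<emptyset>\<close>, \<open>w\<^sub>i = \<Sum>\<^sub>T\<^sub>\<ni>\<^sub>i (c\<^sub>T\<^sub>,\<^sub>\<emptyset> - c\<^sub>T\<^sub>,\<^sub>i)\<close> and, for a non-edge \<open>T = {i, j}\<close>,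
  \<open>c\<^sub>T\<^sub>,\<^sub>\<emptyset> \<le> c\<^sub>T\<^sub>,\<^sub>i + c\<^sub>T\<^sub>,\<^sub>j\<close>. Hence the contribution of a non-edge can be moved to its two endpoints
  at total cost at most \<open>c\<^sub>T\<^sub>,\<^sub>\<emptyset>\<close>, which produces a family of clique weights of total at most \<open>r\<close>
  covering each node at least \<open>w\<close> times. Overcoverage is removed without changing the total by
  shifting weight from \<open>C\<close> to \<open>C - {i}\<close>.\<close>

section \<open>Evaluation of polynomials at real points\<close>

text \<open>Evaluation at the point \<open>x\<close>, written out over the supports. The simp rules
  that follow make it a ring homomorphism, so that a polynomial identity becomes a family of
  identities between real numbers.\<close>

definition peval :: "('a \<Rightarrow> real) \<Rightarrow> 'a rpoly \<Rightarrow> real" where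
  "peval x p = (\<Sum>m\<in>Poly_Mapping.keys p. Poly_Mapping.lookup p m *
     (\<Prod>i\<in>Poly_Mapping.keys m. x i ^ Poly_Mapping.lookup m i))"

lemma peval_zero [simp]: "peval x 0 = 0"
  by (simp add: peval_def)

lemma peval_single:
  "peval x (Poly_Mapping.single m a) =
     a * (\<Prod>i\<in>Poly_Mapping.keys m. x i ^ Poly_Mapping.lookup m i)"
  by (simp add: peval_def)

lemma peval_PConst [simp]: "peval x (PConst c) = c"
  by (simp add: PConst_def peval_single)

lemma peval_one [simp]: "peval x 1 = 1"
  by (simp add: peval_single flip: single_one)

lemma peval_PVar [simp]: "peval x (PVar i) = x i"
  by (simp add: PVar_def peval_single)

lemma peval_add [simp]: "peval x (p + q) = peval x p + peval x q"
  unfolding peval_def by (rule setsum_keys_plus_distrib) (simp_all add: distrib_right)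

lemma peval_diff [simp]: "peval x (p - q) = peval x p - peval x q"
  by (metis add_diff_cancel_right' diff_add_cancel peval_add)

lemma peval_sum [simp]: "peval x (\<Sum>a\<in>A. f a) = (\<Sum>a\<in>A. peval x (f a))"
  by (induction A rule: infinite_finite_induct) auto

text \<open>Decomposition into monomials: it reduces multiplicativity of \<open>peval\<close> to
  products of two monomials.\<close>

lemma poly_mapping_eq_sum_single:
  "p = (\<Sum>m\<in>Poly_Mapping.keys p. Poly_Mapping.single m (Poly_Mapping.lookup p m))"
proof (rule poly_mapping_eqI)
  fix k
  show "Poly_Mapping.lookup p k = Poly_Mapping.lookup
      (\<Sum>m\<in>Poly_Mapping.keys p. Poly_Mapping.single m (Poly_Mapping.lookup p m)) k"
    by (simp add: lookup_sum lookup_single when_def in_keys_iff)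
qed

text \<open>Variables with exponent 0 contribute the factor 1, so all three products may be taken
  over the union of the two supports, where exponents simply add.\<close>

lemma prod_power_keys_add:
  fixes x :: "'a \<Rightarrow> real" and a b :: "'a \<Rightarrow>\<^sub>0 nat"
  shows "(\<Prod>i\<in>Poly_Mapping.keys (a + b). x i ^ Poly_Mapping.lookup (a + b) i) =
    (\<Prod>i\<in>Poly_Mapping.keys a. x i ^ Poly_Mapping.lookup a i) *
    (\<Prod>i\<in>Poly_Mapping.keys b. x i ^ Poly_Mapping.lookup b i)"
proof -
  let ?K = "Poly_Mapping.keys a \<union> Poly_Mapping.keys b"
  have ext: "(\<Prod>i\<in>Poly_Mapping.keys m. x i ^ Poly_Mapping.lookup m i) =
      (\<Prod>i\<in>?K. x i ^ Poly_Mapping.lookup m i)" if "Poly_Mapping.keys m \<subseteq> ?K" for m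
    using that by (intro prod.mono_neutral_left) (auto simp: in_keys_iff)
  show ?thesis
    using ext[of a] ext[of b] ext[of "a + b"] keys_add[of a b]
    by (simp add: lookup_add power_add prod.distrib)
qed

lemma peval_mult [simp]: "peval x (p * q) = peval x p * peval x q"
proof -
  let ?s = "\<lambda>p::'a rpoly. \<lambda>m. Poly_Mapping.single m (Poly_Mapping.lookup p m)"
  have mono: "peval x (Poly_Mapping.single a c * Poly_Mapping.single b d) =
      peval x (Poly_Mapping.single a c) * peval x (Poly_Mapping.single b d)" for a b c d
    by (simp add: mult_single peval_single prod_power_keys_add)
  have "p * q = (\<Sum>a\<in>Poly_Mapping.keys p. \<Sum>b\<in>Poly_Mapping.keys q. ?s p a * ?s q b)"
    by (subst poly_mapping_eq_sum_single[of p], subst poly_mapping_eq_sum_single[of q])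
      (rule sum_product)
  then have "peval x (p * q) =
      (\<Sum>a\<in>Poly_Mapping.keys p. \<Sum>b\<in>Poly_Mapping.keys q. peval x (?s p a) * peval x (?s q b))"
    by (simp add: mono)
  also have "\<dots> = peval x (\<Sum>a\<in>Poly_Mapping.keys p. ?s p a) * peval x (\<Sum>b\<in>Poly_Mapping.keys q. ?s q b)"
    by (simp add: sum_product)
  finally show ?thesis
    by (simp only: poly_mapping_eq_sum_single[symmetric])
qed

lemma peval_prod [simp]: "peval x (\<Prod>a\<in>A. f a) = (\<Prod>a\<in>A. peval x (f a))"
  by (induction A rule: infinite_finite_induct) auto

lemma PConst_zero [simp]: "PConst 0 = 0"
  by (simp add: PConst_def)

lemma PConst_add: "PConst (a + b) = PConst a + PConst b"
  by (simp add: PConst_def single_add)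

lemma PConst_diff: "PConst (a - b) = PConst a - PConst b"
  by (simp add: PConst_def single_diff)

lemma PConst_sum: "PConst (\<Sum>a\<in>A. f a) = (\<Sum>a\<in>A. PConst (f a))"
  by (induction A rule: infinite_finite_induct) (auto simp: PConst_add)

section \<open>Handelman forms at 0/1 points\<close>

lemma prod_indicator:
  "finite A \<Longrightarrow> (\<Prod>i\<in>A. indicator S i :: real) = (if A \<subseteq> S then 1 else 0)"
  by (induction A rule: finite_induct) (auto simp: indicator_def)

lemma prod_one_minus_indicator:
  "finite A \<Longrightarrow> (\<Prod>i\<in>A. 1 - indicator S i :: real) = (if A \<inter> S = {} then 1 else 0)"
  by (induction A rule: finite_induct) (auto simp: indicator_def)

text \<open>At the characteristic vector of \<open>S\<close> the product x^I (1-x)^(T-I) is 1 if I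
  is the intersection of T and S, and 0 for every other subset I of T. Hence exactly one coefficient
  survives for each T.\<close>

lemma peval_handelman_indicator:
  assumes "finite V"
  shows "peval (indicator S) (\<Sum>T\<in>{T. T \<subseteq> V \<and> card T \<le> t}. \<Sum>I\<in>Pow T.
      PConst (c T I) * (\<Prod>i\<in>I. PVar i) * (\<Prod>i\<in>T - I. 1 - PVar i)) =
    (\<Sum>T\<in>{T. T \<subseteq> V \<and> card T \<le> t}. c T (T \<inter> S))"
proof -
  have "(\<Sum>I\<in>Pow T. c T I * (\<Prod>i\<in>I. indicator S i) * (\<Prod>i\<in>T - I. 1 - indicator S i)) =
      c T (T \<inter> S)" if "T \<subseteq> V" for T
  proof -
    have fT: "finite T" using that assms finite_subset by blast
    have "(\<Sum>I\<in>Pow T. c T I * (\<Prod>i\<in>I. indicator S i) * (\<Prod>i\<in>T - I. 1 - indicator S i)) =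
       (\<Sum>I\<in>Pow T. if I = T \<inter> S then c T I else 0)"
    proof (rule sum.cong)
      fix I assume "I \<in> Pow T"
      then have "finite I" "I \<subseteq> T" using fT finite_subset by auto
      moreover have "I = T \<inter> S \<longleftrightarrow> I \<subseteq> S \<and> (T - I) \<inter> S = {}"
        using \<open>I \<subseteq> T\<close> by blast
      ultimately show "c T I * (\<Prod>i\<in>I. indicator S i) * (\<Prod>i\<in>T - I. 1 - indicator S i) =
          (if I = T \<inter> S then c T I else 0)"
        using fT by (simp add: prod_indicator prod_one_minus_indicator)
    qed simp
    also have "\<dots> = c T (T \<inter> S)" using fT by simp
    finally show ?thesis .
  qed
  then show ?thesis by simp
qed

section \<open>Cliques of bounded size\<close>

lemma simple_graph_finite:
  assumes "simple_graph V E"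
  shows "finite V" "finite E"
proof -
  show "finite V" using assms by (simp add: simple_graph_def)
  then show "finite E"
    using assms by (auto simp: simple_graph_def intro: finite_subset[of E "Pow V"])
qed

lemma simple_graph_edge:
  assumes "simple_graph V E" "e \<in> E"
  shows "e \<subseteq> V" "finite e" "card e = 2"
  using assms finite_subset unfolding simple_graph_def by blast+

lemma finite_bounded_cliques:
  assumes "simple_graph V E"
  shows "finite (bounded_cliques V E t)"
  using simple_graph_finite[OF assms]
  by (auto simp: bounded_cliques_def clique_def intro: finite_subset[of _ "Pow V"])

lemma bounded_cliqueD:
  assumes "simple_graph V E" "C \<in> bounded_cliques V E t"
  shows "finite C" "C \<subseteq> V" "card C \<le> t"
  using assms simple_graph_finite(1)[OF assms(1)] finite_subset
  by (auto simp: bounded_cliques_def clique_def)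

text \<open>This closure under subsets is what allows weight to be moved from a clique to a smaller
  one.\<close>

lemma bounded_cliques_subset:
  assumes "simple_graph V E" "C \<in> bounded_cliques V E t" "D \<subseteq> C"
  shows "D \<in> bounded_cliques V E t"
proof -
  have "card D \<le> card C"
    using bounded_cliqueD[OF assms(1,2)] assms(3) by (auto intro: card_mono)
  then show ?thesis
    using assms unfolding bounded_cliques_def clique_def by auto
qed

lemma singleton_bounded_clique:
  "i \<in> V \<Longrightarrow> 1 \<le> t \<Longrightarrow> {i} \<in> bounded_cliques V E t"
  by (simp add: bounded_cliques_def clique_def)

lemma edge_bounded_clique:
  assumes "simple_graph V E" "e \<in> E"
  shows "e \<in> bounded_cliques V E 2"
proof -
  obtain i j where e: "e = {i, j}"
    using simple_graph_edge(3)[OF assms] by (auto simp: card_2_iff)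
  then show ?thesis
    using simple_graph_edge[OF assms] assms(2)
    by (auto simp: bounded_cliques_def clique_def insert_commute)
qed

lemma bounded_clique_2_cases:
  assumes "simple_graph V E" "C \<in> bounded_cliques V E 2"
  obtains "C = {}" | i where "i \<in> V" "C = {i}"
    | i j where "i \<noteq> j" "C = {i, j}" "C \<in> E"
proof -
  note C = bounded_cliqueD[OF assms]
  then consider "card C = 0" | "card C = 1" | "card C = 2" by linarith
  then show thesis
  proof cases
    case 1 then show ?thesis using C that(1) by simp
  next
    case 2 then show ?thesis using C that(2) by (auto simp: card_1_singleton_iff)
  next
    case 3
    then obtain i j where "i \<noteq> j" "C = {i, j}" by (auto simp: card_2_iff)
    then show ?thesis using that(3) assms(2) by (auto simp: bounded_cliques_def clique_def)
  qed
qed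

section \<open>From overcovers to exact covers\<close>

text \<open>Every clique D containing i keeps the fraction \<theta> of its weight and passes the
  rest to D - {i}. This multiplies the coverage of i by \<theta>. The total and the coverage of any
  other node stay the same, because D and D - {i} agree away from i.\<close>

lemma exact_cover_at:
  fixes l :: "'a set \<Rightarrow> real"
  assumes G: "simple_graph V E"
    and l: "\<forall>C\<in>bounded_cliques V E t. 0 \<le> l C"
    and i: "i \<in> V" "0 \<le> a" "a \<le> (\<Sum>C\<in>bounded_cliques V E t. l C * indicator C i)"
  shows "\<exists>l'. (\<forall>C\<in>bounded_cliques V E t. 0 \<le> l' C) \<and>
    (\<Sum>C\<in>bounded_cliques V E t. l' C) = (\<Sum>C\<in>bounded_cliques V E t. l C) \<and>
    (\<Sum>C\<in>bounded_cliques V E t. l' C * indicator C i) = a \<and>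
    (\<forall>j. j \<noteq> i \<longrightarrow> (\<Sum>C\<in>bounded_cliques V E t. l' C * indicator C j) =
       (\<Sum>C\<in>bounded_cliques V E t. l C * indicator C j))"
proof -
  let ?B = "bounded_cliques V E t"
  note fB = finite_bounded_cliques[OF G, of t]
  define s where "s = (\<Sum>C\<in>?B. l C * indicator C i)"
  \<comment> \<open>If \<open>s = 0\<close> then \<open>a = 0\<close>, and division by zero yields
    \<open>\<theta> = 0\<close>, so \<open>\<theta> * s = a\<close> holds in this case as
    well.\<close>
  define \<theta> where "\<theta> = a / s"
  have s0: "0 \<le> s" unfolding s_def using l by (intro sum_nonneg) auto
  have th: "0 \<le> \<theta>" "\<theta> \<le> 1" "\<theta> * s = a"
    using i s0 by (auto simp: \<theta>_def s_def[symmetric] divide_le_eq_1)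
  define l' where "l' C =
    (\<Sum>D\<in>?B. l D * (if i \<in> D then \<theta> * of_bool (C = D) + (1 - \<theta>) * of_bool (C = D - {i})
                else of_bool (C = D)))" for C
  \<comment> \<open>The new weighting is tested against an arbitrary \<open>f\<close>. Taking for
    \<open>f\<close> the constant 1, membership of i and membership of j gives the total and both
    kinds of coverage.\<close>
  have agg: "(\<Sum>C\<in>?B. l' C * f C) =
      (\<Sum>D\<in>?B. l D * (if i \<in> D then \<theta> * f D + (1 - \<theta>) * f (D - {i}) else f D))" for f
  proof -
    have delta: "(\<Sum>C\<in>?B. of_bool (C = D) * f C) = f D" if "D \<in> ?B" for D
      using that fB by (simp add: of_bool_def if_distrib[of "\<lambda>x. x * _"] cong: if_cong)
    have "(\<Sum>C\<in>?B. l' C * f C) = (\<Sum>D\<in>?B. \<Sum>C\<in>?B. l D *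
        (if i \<in> D then \<theta> * of_bool (C = D) + (1 - \<theta>) * of_bool (C = D - {i})
                else of_bool (C = D)) * f C)"
      unfolding l'_def sum_distrib_right by (rule sum.swap)
    also have "\<dots> = (\<Sum>D\<in>?B. l D * (if i \<in> D
        then \<theta> * (\<Sum>C\<in>?B. of_bool (C = D) * f C) + (1 - \<theta>) * (\<Sum>C\<in>?B. of_bool (C = D - {i}) * f C)
        else (\<Sum>C\<in>?B. of_bool (C = D) * f C)))"
      by (intro sum.cong refl)
        (simp add: sum_distrib_left sum.distrib[symmetric] algebra_simps)
    also have "\<dots> = (\<Sum>D\<in>?B. l D * (if i \<in> D then \<theta> * f D + (1 - \<theta>) * f (D - {i}) else f D))"
    proof (intro sum.cong refl)
      fix D assume D: "D \<in> ?B"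
      then have "D - {i} \<in> ?B" using bounded_cliques_subset[OF G D] by blast
      then show "l D * (if i \<in> D
        then \<theta> * (\<Sum>C\<in>?B. of_bool (C = D) * f C) + (1 - \<theta>) * (\<Sum>C\<in>?B. of_bool (C = D - {i}) * f C)
        else (\<Sum>C\<in>?B. of_bool (C = D) * f C)) =
        l D * (if i \<in> D then \<theta> * f D + (1 - \<theta>) * f (D - {i}) else f D)"
        using D by (simp only: delta)
    qed
    finally show ?thesis .
  qed
  show ?thesis
  proof (intro exI[of _ l'] conjI ballI allI impI)
    show "0 \<le> l' C" if "C \<in> ?B" for C
      unfolding l'_def using l th by (intro sum_nonneg mult_nonneg_nonneg) auto
    have "(\<Sum>C\<in>?B. l' C * 1) = (\<Sum>C\<in>?B. l C)"
      unfolding agg by (intro sum.cong) auto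
    then show "(\<Sum>C\<in>?B. l' C) = (\<Sum>C\<in>?B. l C)" by simp
    have "(\<Sum>C\<in>?B. l' C * indicator C i) = (\<Sum>D\<in>?B. \<theta> * (l D * indicator D i))"
      unfolding agg by (intro sum.cong) auto
    then show "(\<Sum>C\<in>?B. l' C * indicator C i) = a"
      using th by (simp add: s_def sum_distrib_left)
    show "(\<Sum>C\<in>?B. l' C * indicator C j) = (\<Sum>C\<in>?B. l C * indicator C j)" if "j \<noteq> i" for j
      unfolding agg using that by (intro sum.cong) (auto simp: indicator_def)
  qed
qed

text \<open>Nodes are corrected one at a time, by induction on the set \<open>U\<close> of nodes
  already covered exactly. Correcting i leaves the coverage of all other nodes alone, so
  \<open>U\<close> stays exact and the remaining nodes stay overcovered.\<close>

lemma cover_from_overcover: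
  assumes G: "simple_graph V E" and w: "\<And>i. i \<in> V \<Longrightarrow> 0 \<le> w i"
    and l: "\<And>C. C \<in> bounded_cliques V E t \<Longrightarrow> 0 \<le> l C"
    and over: "\<And>i. i \<in> V \<Longrightarrow> w i \<le> (\<Sum>C\<in>bounded_cliques V E t. l C * indicator C i)"
  obtains l' where "fractional_clique_cover V E w t l'"
    "(\<Sum>C\<in>bounded_cliques V E t. l' C) = (\<Sum>C\<in>bounded_cliques V E t. l C)"
proof -
  let ?B = "bounded_cliques V E t"
  let ?cov = "\<lambda>l i. \<Sum>C\<in>?B. l C * indicator C i :: real"
  have "\<exists>l'. (\<forall>C\<in>?B. 0 \<le> l' C) \<and> (\<Sum>C\<in>?B. l' C) = (\<Sum>C\<in>?B. l C) \<and>
      (\<forall>i\<in>U. ?cov l' i = w i) \<and> (\<forall>i\<in>V - U. w i \<le> ?cov l' i)"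
    if "finite U" "U \<subseteq> V" for U
    using that
  proof (induction U rule: finite_induct)
    case empty
    then show ?case using l over by (intro exI[of _ l]) auto
  next
    case (insert i U)
    then obtain l1 where l1: "\<forall>C\<in>?B. 0 \<le> l1 C" "(\<Sum>C\<in>?B. l1 C) = (\<Sum>C\<in>?B. l C)"
      "\<forall>j\<in>U. ?cov l1 j = w j" "\<forall>j\<in>V - U. w j \<le> ?cov l1 j" by auto
    have i: "i \<in> V" "0 \<le> w i" "w i \<le> ?cov l1 i" using insert w l1 by auto
    obtain l2 where l2: "(\<forall>C\<in>?B. 0 \<le> l2 C) \<and> (\<Sum>C\<in>?B. l2 C) = (\<Sum>C\<in>?B. l1 C) \<and>
      ?cov l2 i = w i \<and> (\<forall>j. j \<noteq> i \<longrightarrow> ?cov l2 j = ?cov l1 j)"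
      using exact_cover_at[OF G l1(1) i] ..
    have "?cov l2 j = w j" if "j \<in> insert i U" for j
      using l2 l1(3) that by (cases "j = i") auto
    moreover have "w j \<le> ?cov l2 j" if "j \<in> V - insert i U" for j
    proof -
      from that have "j \<noteq> i" "j \<in> V - U" by auto
      then show ?thesis using l2 l1(4) by auto
    qed
    ultimately show ?case using l2 l1(2) by (intro exI[of _ l2]) auto
  qed
  from this[OF simple_graph_finite(1)[OF G] order_refl] show thesis
    using that unfolding fractional_clique_cover_def by auto
qed

section \<open>From Handelman representations to clique covers\<close>

lemma peval_graph_poly_indicator:
  assumes "simple_graph V E" "S \<subseteq> V"
  shows "peval (indicator S) (graph_poly V E w wE) = (\<Sum>i\<in>S. w i) - (\<Sum>e\<in>{e\<in>E. e \<subseteq> S}. wE e)"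
proof -
  note fin = simple_graph_finite[OF assms(1)]
  have "(\<Sum>i\<in>V. w i * indicator S i) = (\<Sum>i\<in>S. w i)"
    using assms(2) fin by (simp add: indicator_def if_distrib[of "\<lambda>x. _ * x"] sum.If_cases
      Int_absorb1 Collect_conj_eq cong: if_cong)
  moreover have "(\<Sum>e\<in>E. wE e * (\<Prod>i\<in>e. indicator S i)) = (\<Sum>e\<in>{e\<in>E. e \<subseteq> S}. wE e)"
    unfolding sum.inter_filter[OF fin(2)]
    using simple_graph_edge(2)[OF assms(1)] by (intro sum.cong) (auto simp: prod_indicator)
  ultimately show ?thesis unfolding graph_poly_def by simp
qed

text \<open>Here \<open>d\<close> stands for \<open>c T {}\<close> and \<open>b i\<close> for
  \<open>c T {i}\<close>. A clique T receives the whole weight \<open>d\<close>. For a non-edge {i,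
  j}, each endpoint k receives the positive part of \<open>d - b k\<close>: if both parts are
  positive, the total is 2d - b_i - b_j, which is at most d by \<open>nonedge\<close>; otherwise at
  most one part counts, and it is at most d.\<close>

lemma local_overcover:
  fixes d :: real and b :: "'a \<Rightarrow> real"
  assumes G: "simple_graph V E" and T: "T \<subseteq> V" "card T \<le> 2" and d: "0 \<le> d"
    and b: "\<And>i. 0 \<le> b i"
    and nonedge: "\<And>i j. i \<noteq> j \<Longrightarrow> T = {i, j} \<Longrightarrow> T \<notin> E \<Longrightarrow> d \<le> b i + b j"
  shows "\<exists>l. (\<forall>C. 0 \<le> l C) \<and> (\<Sum>C\<in>bounded_cliques V E 2. l C) \<le> d \<and>
    (\<forall>i\<in>T. d - b i \<le> (\<Sum>C\<in>bounded_cliques V E 2. l C * indicator C i))"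
proof -
  let ?B = "bounded_cliques V E 2"
  note fB = finite_bounded_cliques[OF G, of 2]
  show ?thesis
  proof (cases "T \<in> ?B")
    case True
    define l where "l C = (if C = T then d else 0)" for C
    have "(\<Sum>C\<in>?B. l C * f C) = d * f T" for f
      using True fB by (simp add: l_def if_distrib[of "\<lambda>x. x * _"] cong: if_cong)
    from this[of "\<lambda>_. 1"] this show ?thesis
      using d b by (intro exI[of _ l]) (auto simp: l_def)
  next
    case False
    have "finite T" using T simple_graph_finite(1)[OF G] finite_subset by blast
    have "T \<noteq> {}" using False by (auto simp: bounded_cliques_def clique_def)
    moreover have "card T \<noteq> 1"
      using False T singleton_bounded_clique[of _ V 2 E] by (auto simp: card_1_singleton_iff)
    ultimately have "card T = 2"
      using T \<open>finite T\<close> by (metis One_nat_def card_0_eq le_Suc_eq le_zero_eq numeral_2_eq_2)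
    then obtain i j where ij: "i \<noteq> j" "T = {i, j}" by (auto simp: card_2_iff)
    then have "T \<notin> E" using False edge_bounded_clique[OF G] by blast
    then have sumb: "d \<le> b i + b j" using nonedge ij by blast
    define l where "l C = (if C = {i} then max 0 (d - b i) else 0)
      + (if C = {j} then max 0 (d - b j) else 0)" for C
    have B: "{i} \<in> ?B" "{j} \<in> ?B" using T ij by (auto intro: singleton_bounded_clique)
    have agg: "(\<Sum>C\<in>?B. l C * f C) = max 0 (d - b i) * f {i} + max 0 (d - b j) * f {j}" for f
      using B fB by (simp add: l_def distrib_right sum.distrib
        if_distrib[of "\<lambda>x. x * _"] cong: if_cong)
    show ?thesis
    proof (intro exI[of _ l] conjI allI ballI)
      show "0 \<le> l C" for C by (simp add: l_def)
      show "(\<Sum>C\<in>?B. l C) \<le> d"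
        using agg[of "\<lambda>_. 1"] sumb b[of i] b[of j] d by (simp add: max_def)
      show "d - b k \<le> (\<Sum>C\<in>?B. l C * indicator C k)" if "k \<in> T" for k
        using that ij unfolding agg by (auto simp: max_def)
    qed
  qed
qed

lemma cover_of_handelman:
  assumes G: "simple_graph V E" and w: "\<And>i. i \<in> V \<Longrightarrow> 0 \<le> w i"
    and H: "PConst r - graph_poly V E w wE \<in> handelman_set V 2"
  obtains l where "fractional_clique_cover V E w 2 l"
    "(\<Sum>C\<in>bounded_cliques V E 2. l C) \<le> r"
proof -
  let ?B = "bounded_cliques V E 2"
  let ?K = "{T. T \<subseteq> V \<and> card T \<le> 2}"
  note fV = simple_graph_finite(1)[OF G]
  have fK: "finite ?K" using fV by (auto intro: finite_subset[of _ "Pow V"])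
  obtain c where c0: "\<And>T I. 0 \<le> c T I" and eq: "PConst r - graph_poly V E w wE =
      (\<Sum>T\<in>?K. \<Sum>I\<in>Pow T. PConst (c T I) * (\<Prod>i\<in>I. PVar i) * (\<Prod>i\<in>T - I. 1 - PVar i))"
    using H unfolding handelman_set_def by blast
  have ev: "r - ((\<Sum>i\<in>S. w i) - (\<Sum>e\<in>{e\<in>E. e \<subseteq> S}. wE e)) = (\<Sum>T\<in>?K. c T (T \<inter> S))"
    if "S \<subseteq> V" for S
    using arg_cong[OF eq, of "peval (indicator S)"]
    unfolding peval_handelman_indicator[OF fV] peval_diff peval_PConst
      peval_graph_poly_indicator[OF G that] .
  \<comment> \<open>An edge has two elements, so inside a set of at most two nodes it can only be
    that set itself.\<close>
  have no_edge: "{e\<in>E. e \<subseteq> S} = {}" if "finite S" "card S \<le> 2" "S \<notin> E" for S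
  proof -
    have "card S < 2 \<or> e = S" if "e \<in> E" "e \<subseteq> S" for e
      using simple_graph_edge[OF G \<open>e \<in> E\<close>] that \<open>finite S\<close> \<open>card S \<le> 2\<close>
      by (metis card_seteq)
    moreover have "2 \<le> card S" if "e \<in> E" "e \<subseteq> S" for e
      using simple_graph_edge[OF G \<open>e \<in> E\<close>] that \<open>finite S\<close> by (metis card_mono)
    ultimately show ?thesis using that by fastforce
  qed
  have small: "S \<notin> E" if "card S \<noteq> 2" for S
    using simple_graph_edge(3)[OF G] that by blast
  have ev_indep: "r - (\<Sum>i\<in>S. w i) = (\<Sum>T\<in>?K. c T (T \<inter> S))"
    if "S \<subseteq> V" "card S \<le> 2" "S \<notin> E" for S
  proof -
    have "finite S" using that(1) fV finite_subset by blast
    then show ?thesis using ev[OF that(1)] unfolding no_edge[OF \<open>finite S\<close> that(2,3)] by simp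
  qed
  have r: "r = (\<Sum>T\<in>?K. c T {})"
    using ev_indep[of "{}"] small[of "{}"] by simp
  have ev1: "r - w i = (\<Sum>T\<in>?K. c T (T \<inter> {i}))" if "i \<in> V" for i
    using ev_indep[of "{i}"] small[of "{i}"] that by simp
  \<comment> \<open>Take the second difference of the evaluations at T, {i}, {j} and the empty set.
    The left-hand sides cancel because T is not an edge. On the right every U missing i or j
    cancels, and the only U of size at most two containing both is T. This leaves c_TT = c_Ti + c_Tj
    - c_T{}, and c_TT is nonnegative.\<close>
  have nonedge: "c T {} \<le> c T {i} + c T {j}"
    if T: "T \<in> ?K" and ij: "i \<noteq> j" "T = {i, j}" "T \<notin> E" for T i j
  proof -
    let ?q = "\<lambda>U. c U (U \<inter> T) - c U (U \<inter> {i}) - c U (U \<inter> {j}) + c U {}"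
    have "r - (w i + w j) = (\<Sum>U\<in>?K. c U (U \<inter> T))"
      using ev_indep[of T] T ij by simp
    then have "0 = (\<Sum>U\<in>?K. ?q U)"
      using ev1[of i] ev1[of j] r T ij by (simp add: sum.distrib sum_subtractf)
    also have "\<dots> = (\<Sum>U\<in>?K. if U = T then ?q T else 0)"
    proof (rule sum.cong)
      fix U assume U: "U \<in> ?K"
      consider "i \<notin> U" | "j \<notin> U" | "T \<subseteq> U" using ij by blast
      then show "?q U = (if U = T then ?q T else 0)"
      proof cases
        case 1
        then have "U \<inter> T = U \<inter> {j}" "U \<inter> {i} = {}" using ij by auto
        then show ?thesis using 1 ij by auto
      next
        case 2
        then have "U \<inter> T = U \<inter> {i}" "U \<inter> {j} = {}" using ij by auto
        then show ?thesis using 2 ij by auto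
      next
        case 3
        have "finite U" using U fV finite_subset by blast
        moreover have "card U \<le> card T" using U ij by simp
        ultimately have "U = T" using 3 card_seteq by metis
        then show ?thesis by simp
      qed
    qed simp
    also have "\<dots> = ?q T" using T fK by simp
    also have "\<dots> = c T T - c T {i} - c T {j} + c T {}"
      using ij by (simp add: Int_commute)
    finally show ?thesis using c0[of T T] by linarith
  qed
  \<comment> \<open>Each T is replaced by clique weights of its own; choosing one such family
    \<open>L T\<close> for every T and adding them up gives the overcover.\<close>
  have "\<forall>T\<in>?K. \<exists>l. (\<forall>C. 0 \<le> l C) \<and> (\<Sum>C\<in>?B. l C) \<le> c T {} \<and>
      (\<forall>i\<in>T. c T {} - c T {i} \<le> (\<Sum>C\<in>?B. l C * indicator C i))"
    using nonedge by (intro ballI local_overcover[OF G]) (auto intro: c0)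
  from bchoice[OF this]
  obtain L where L0: "\<And>T C. T \<in> ?K \<Longrightarrow> 0 \<le> L T C"
    and Lsum: "\<And>T. T \<in> ?K \<Longrightarrow> (\<Sum>C\<in>?B. L T C) \<le> c T {}"
    and Lcov: "\<And>T i. T \<in> ?K \<Longrightarrow> i \<in> T \<Longrightarrow>
      c T {} - c T {i} \<le> (\<Sum>C\<in>?B. L T C * indicator C i)"
    by blast
  define l where "l C = (\<Sum>T\<in>?K. L T C)" for C
  have l0: "0 \<le> l C" for C unfolding l_def using L0 by (intro sum_nonneg) auto
  have "(\<Sum>C\<in>?B. l C) = (\<Sum>T\<in>?K. \<Sum>C\<in>?B. L T C)"
    unfolding l_def by (rule sum.swap)
  also have "\<dots> \<le> r" unfolding r using Lsum by (intro sum_mono) auto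
  finally have lr: "(\<Sum>C\<in>?B. l C) \<le> r" .
  \<comment> \<open>Subtracting the evaluation at {i} from the one at the empty set isolates
    \<open>w i\<close>; only sets T containing i contribute to the difference.\<close>
  have over: "w i \<le> (\<Sum>C\<in>?B. l C * indicator C i)" if "i \<in> V" for i
  proof -
    have "w i = (\<Sum>T\<in>?K. c T {} - c T (T \<inter> {i}))"
      using ev1[OF that] r by (simp add: sum_subtractf)
    also have "\<dots> \<le> (\<Sum>T\<in>?K. \<Sum>C\<in>?B. L T C * indicator C i)"
    proof (rule sum_mono)
      fix T assume T: "T \<in> ?K"
      show "c T {} - c T (T \<inter> {i}) \<le> (\<Sum>C\<in>?B. L T C * indicator C i)"
      proof (cases "i \<in> T")
        case True
        then show ?thesis using Lcov[OF T True] by (simp add: Int_insert_right)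
      next
        case False
        have "0 \<le> (\<Sum>C\<in>?B. L T C * indicator C i)"
          using L0[OF T] by (intro sum_nonneg mult_nonneg_nonneg) auto
        then show ?thesis using False by simp
      qed
    qed
    also have "\<dots> = (\<Sum>C\<in>?B. l C * indicator C i)"
      unfolding l_def sum_distrib_right by (rule sum.swap)
    finally show ?thesis .
  qed
  obtain l' where "fractional_clique_cover V E w 2 l'" "(\<Sum>C\<in>?B. l' C) = (\<Sum>C\<in>?B. l C)"
  proof (rule cover_from_overcover[where l = l and w = w and t = 2])
    show "simple_graph V E" by (rule G)
    show "0 \<le> w i" if "i \<in> V" for i by (rule w[OF that])
    show "0 \<le> l C" for C by (rule l0)
    show "w i \<le> (\<Sum>C\<in>?B. l C * indicator C i)" if "i \<in> V" for i by (rule over[OF that])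
  qed
  then show thesis using that lr by metis
qed

section \<open>From clique covers to Handelman representations\<close>

text \<open>For a clique of size at most two, (1-x)^C is 1 minus the sum of its variables, plus x^C
  if C is an edge. The terms l_C (1-x)^C therefore sum to the total of \<open>l\<close>, minus the
  linear part of \<open>graph_poly\<close>, plus the terms l_e x^e; adding (w_e - l_e) x^e leaves
  exactly w_e x^e.\<close>

lemma handelman_of_cover:
  assumes G: "simple_graph V E"
    and wE: "\<And>i j. {i, j} \<in> E \<Longrightarrow> min (w i) (w j) \<le> wE {i, j}"
    and l: "fractional_clique_cover V E w 2 l"
  shows "PConst (\<Sum>C\<in>bounded_cliques V E 2. l C) - graph_poly V E w wE \<in> handelman_set V 2"
proof -
  let ?B = "bounded_cliques V E 2"
  let ?K = "{T. T \<subseteq> V \<and> card T \<le> 2}"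
  note fin = simple_graph_finite[OF G]
  note fB = finite_bounded_cliques[OF G, of 2]
  have fK: "finite ?K" using fin by (auto intro: finite_subset[of _ "Pow V"])
  have EB: "E \<subseteq> ?B" using edge_bounded_clique[OF G] by blast
  have BK: "?B \<subseteq> ?K" using bounded_cliqueD[OF G] by blast
  have l0: "0 \<le> l C" if "C \<in> ?B" for C
    using l that by (auto simp: fractional_clique_cover_def)
  have lw: "l C \<le> w i" if "C \<in> ?B" "i \<in> C" for C i
  proof -
    have "i \<in> V" using that bounded_cliqueD[OF G] by blast
    have "l C * indicator C i \<le> (\<Sum>C\<in>?B. l C * indicator C i)"
      using fB that l0 by (intro member_le_sum) auto
    also have "\<dots> = w i" using l \<open>i \<in> V\<close> by (auto simp: fractional_clique_cover_def)
    finally show ?thesis using that by simp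
  qed
  have le: "l e \<le> wE e" if "e \<in> E" for e
  proof -
    obtain i j where "e = {i, j}"
      using simple_graph_edge(3)[OF G \<open>e \<in> E\<close>] by (auto simp: card_2_iff)
    then show ?thesis
      using wE[of i j] lw[of e i] lw[of e j] that EB by auto
  qed
  \<comment> \<open>The cases \<open>I = {}\<close> and \<open>I = T\<close> could collide only at
    \<open>T = {}\<close>, which is not an edge by \<open>ne\<close>; this lets \<open>inner\<close>
    split into two independent summands.\<close>
  define c where "c T I = (if I = {} then if T \<in> ?B then l T else 0
    else if I = T \<and> T \<in> E then wE T - l T else 0)" for T I
  have c0: "0 \<le> c T I" for T I using l0 le by (auto simp: c_def)
  have ne: "{} \<notin> E" using simple_graph_edge(3)[OF G, of "{}"] by auto
  let ?term = "\<lambda>T I. PConst (c T I) * (\<Prod>i\<in>I. PVar i) * (\<Prod>i\<in>T - I. 1 - PVar i)"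
  have inner: "(\<Sum>I\<in>Pow T. ?term T I) =
      (if T \<in> ?B then PConst (l T) * (\<Prod>i\<in>T. 1 - PVar i) else 0) +
      (if T \<in> E then PConst (wE T - l T) * (\<Prod>i\<in>T. PVar i) else 0)" if "T \<in> ?K" for T
  proof -
    have fT: "finite T" using that fin finite_subset by blast
    have "(\<Sum>I\<in>Pow T. ?term T I) = (\<Sum>I\<in>Pow T.
       (if I = {} then if T \<in> ?B then PConst (l T) * (\<Prod>i\<in>T. 1 - PVar i) else 0 else 0) +
       (if I = T then if T \<in> E then PConst (wE T - l T) * (\<Prod>i\<in>T. PVar i) else 0 else 0))"
      using ne by (intro sum.cong) (auto simp: c_def)
    also have "\<dots> = (if T \<in> ?B then PConst (l T) * (\<Prod>i\<in>T. 1 - PVar i) else 0) +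
      (if T \<in> E then PConst (wE T - l T) * (\<Prod>i\<in>T. PVar i) else 0)"
      using fT unfolding sum.distrib by simp
    finally show ?thesis .
  qed
  have expand: "(\<Prod>i\<in>T. 1 - PVar i) = 1 - (\<Sum>i\<in>T. PVar i) + (if T \<in> E then \<Prod>i\<in>T. PVar i else 0)"
    if "T \<in> ?B" for T :: "'a set"
    using G that
  proof (cases rule: bounded_clique_2_cases)
    case 1 then show ?thesis using ne by simp
  next
    case (2 i)
    then have "T \<notin> E" using simple_graph_edge(3)[OF G, of T] by auto
    then show ?thesis using 2 by simp
  next
    case (3 i j)
    then show ?thesis by (auto simp: algebra_simps)
  qed
  \<comment> \<open>After swapping the sums, the coefficient of x_i is the coverage of i. Exactness
    of the cover is used here: it makes this coefficient equal to \<open>w i\<close>.\<close>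
  have lin: "(\<Sum>T\<in>?B. PConst (l T) * (\<Sum>i\<in>T. PVar i)) = (\<Sum>i\<in>V. PConst (w i) * PVar i)"
  proof -
    have "(\<Sum>T\<in>?B. PConst (l T) * (\<Sum>i\<in>T. PVar i)) =
        (\<Sum>T\<in>?B. \<Sum>i\<in>V. PConst (l T * indicator T i) * PVar i)"
    proof (rule sum.cong)
      fix T assume "T \<in> ?B"
      then have "V \<inter> T = T" using bounded_cliqueD[OF G] by blast
      have "(\<Sum>i\<in>V. PConst (l T * indicator T i) * PVar i) =
          (\<Sum>i\<in>V. if i \<in> T then PConst (l T) * PVar i else 0)"
        by (intro sum.cong) auto
      also have "\<dots> = (\<Sum>i\<in>T. PConst (l T) * PVar i)"
        using fin \<open>V \<inter> T = T\<close> by (simp add: sum.inter_restrict[symmetric])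
      finally show "PConst (l T) * (\<Sum>i\<in>T. PVar i) =
          (\<Sum>i\<in>V. PConst (l T * indicator T i) * PVar i)"
        by (simp add: sum_distrib_left)
    qed simp
    also have "\<dots> = (\<Sum>i\<in>V. PConst (\<Sum>T\<in>?B. l T * indicator T i) * PVar i)"
      unfolding PConst_sum sum_distrib_right by (rule sum.swap)
    also have "\<dots> = (\<Sum>i\<in>V. PConst (w i) * PVar i)"
      using l by (intro sum.cong) (auto simp: fractional_clique_cover_def)
    finally show ?thesis .
  qed
  have restrict: "(\<Sum>T\<in>A. if T \<in> A' then f T else 0) = (\<Sum>T\<in>A'. f T)"
    if "finite A" "A' \<subseteq> A" for A A' :: "'a set set" and f :: "'a set \<Rightarrow> 'a rpoly"
    using that by (simp add: sum.inter_restrict[symmetric] Int_absorb1)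
  have "(\<Sum>T\<in>?K. \<Sum>I\<in>Pow T. ?term T I) =
      (\<Sum>T\<in>?B. PConst (l T) * (\<Prod>i\<in>T. 1 - PVar i)) +
      (\<Sum>T\<in>E. PConst (wE T - l T) * (\<Prod>i\<in>T. PVar i))"
    using inner restrict[OF fK BK] restrict[OF fK order_trans[OF EB BK]]
    by (simp add: sum.distrib)
  also have "(\<Sum>T\<in>?B. PConst (l T) * (\<Prod>i\<in>T. 1 - PVar i)) =
      (\<Sum>T\<in>?B. PConst (l T) - PConst (l T) * (\<Sum>i\<in>T. PVar i) +
        (if T \<in> E then PConst (l T) * (\<Prod>i\<in>T. PVar i) else 0))"
    by (intro sum.cong refl) (simp add: expand algebra_simps)
  also have "\<dots> = PConst (\<Sum>C\<in>?B. l C) - (\<Sum>i\<in>V. PConst (w i) * PVar i) +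
      (\<Sum>T\<in>E. PConst (l T) * (\<Prod>i\<in>T. PVar i))"
    using lin restrict[OF fB EB] by (simp add: sum.distrib sum_subtractf PConst_sum)
  finally have "PConst (\<Sum>C\<in>?B. l C) - graph_poly V E w wE = (\<Sum>T\<in>?K. \<Sum>I\<in>Pow T. ?term T I)"
    by (simp add: graph_poly_def PConst_diff left_diff_distrib sum_subtractf)
  then show ?thesis unfolding handelman_set_def using c0 by blast
qed

section \<open>Existence of an optimal cover\<close>

text \<open>The witness puts weight \<open>w i\<close> on each singleton {i}; the bound
  \<open>1 \<le> t\<close> admits singletons as cliques. Written as a sum over V, the weight is
  automatically 0 on all other sets.\<close>

lemma fractional_clique_cover_exists:
  assumes G: "simple_graph V E" and w: "\<And>i. i \<in> V \<Longrightarrow> 0 \<le> w i" and t: "1 \<le> t"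
  shows "\<exists>l. fractional_clique_cover V E w t l"
proof -
  let ?B = "bounded_cliques V E t"
  define l where "l C = (\<Sum>i\<in>V. if C = {i} then w i else 0)" for C
  have "(\<Sum>C\<in>?B. l C * indicator C j) = w j" if "j \<in> V" for j
  proof -
    have "(\<Sum>C\<in>?B. l C * indicator C j) =
        (\<Sum>i\<in>V. \<Sum>C\<in>?B. (if C = {i} then w i else 0) * indicator C j)"
      unfolding l_def sum_distrib_right by (rule sum.swap)
    also have "\<dots> = (\<Sum>i\<in>V. w i * indicator {i} j)"
      using t finite_bounded_cliques[OF G, of t] singleton_bounded_clique[of _ V t E]
      by (intro sum.cong) (auto simp: if_distrib[of "\<lambda>x. x * _"] cong: if_cong)
    also have "\<dots> = (\<Sum>i\<in>V. if i = j then w i else 0)"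
      by (intro sum.cong) auto
    also have "\<dots> = w j" using that simple_graph_finite(1)[OF G] by simp
    finally show ?thesis .
  qed
  moreover have "0 \<le> l C" for C unfolding l_def using w by (intro sum_nonneg) auto
  ultimately show ?thesis unfolding fractional_clique_cover_def by blast
qed

text \<open>A continuous function attains its minimum on a compact set. Attainment matters because
  the cover number is a \<open>LEAST\<close>, which is determined only when the optimum is
  reached.\<close>

lemma fractional_clique_cover_min_exists:
  assumes G: "simple_graph V E" and w: "\<And>i. i \<in> V \<Longrightarrow> 0 \<le> w i" and t: "1 \<le> t"
  obtains l where "fractional_clique_cover V E w t l"
    "\<And>l'. fractional_clique_cover V E w t l' \<Longrightarrow>
       (\<Sum>C\<in>bounded_cliques V E t. l C) \<le> (\<Sum>C\<in>bounded_cliques V E t. l' C)"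
proof -
  let ?B = "bounded_cliques V E t"
  let ?tot = "\<lambda>l. \<Sum>C\<in>?B. l C :: real"
  note fB = finite_bounded_cliques[OF G, of t]
  obtain l0 where l0: "fractional_clique_cover V E w t l0"
    using fractional_clique_cover_exists[where w = w, OF G _ t] w by blast
  \<comment> \<open>Weightings are functions on all sets, so coordinates outside the cliques are
    pinned to 0. Clique coordinates are capped by the total of one known cover \<open>l0\<close>,
    and a product of compact sets is compact.\<close>
  define X where "X = Pi\<^sub>E UNIV (\<lambda>C. if C \<in> ?B then {0..?tot l0} else {0})"
  define F where "F = (\<Inter>i\<in>V. {l. (\<Sum>C\<in>?B. l C * indicator C i) = w i})"
  have "compactin (product_topology (\<lambda>_. euclidean) UNIV) X"
    unfolding X_def compactin_PiE by simp
  then have "compact X" by (simp add: euclidean_product_topology)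
  moreover have "closed F"
    unfolding F_def
    by (intro closed_INT ballI closed_Collect_eq continuous_intros
        continuous_on_product_coordinates)
  ultimately have cpt: "compact (X \<inter> F)" by (rule compact_Int_closed)
  \<comment> \<open>Resetting the irrelevant coordinates to 0 changes neither coverage nor total,
    and a nonnegative weight is at most the total, so covers no costlier than \<open>l0\<close> are
    represented in the compact set.\<close>
  have cut: "(\<lambda>C. if C \<in> ?B then l C else 0) \<in> X \<inter> F"
    if "fractional_clique_cover V E w t l" "?tot l \<le> ?tot l0" for l
  proof -
    have nonneg: "0 \<le> l C" if "C \<in> ?B" for C
      using that \<open>fractional_clique_cover V E w t l\<close> by (auto simp: fractional_clique_cover_def)
    have "l C \<le> ?tot l0" if "C \<in> ?B" for C
      using member_le_sum[of C ?B l] nonneg fB that \<open>?tot l \<le> ?tot l0\<close> by fastforce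
    then show ?thesis
      using that nonneg by (auto simp: X_def F_def fractional_clique_cover_def)
  qed
  have "continuous_on (X \<inter> F) ?tot"
    by (intro continuous_intros continuous_on_subset[OF continuous_on_product_coordinates]) auto
  then obtain l where l: "l \<in> X \<inter> F" and min: "\<And>l'. l' \<in> X \<inter> F \<Longrightarrow> ?tot l \<le> ?tot l'"
    using continuous_attains_inf[OF cpt] cut[OF l0] by blast
  show thesis
  proof (rule that)
    have "0 \<le> l C" if "C \<in> ?B" for C
    proof -
      have "l C \<in> {0..?tot l0}" using l that unfolding X_def by (auto dest: PiE_mem[of _ _ _ C])
      then show ?thesis by simp
    qed
    then show "fractional_clique_cover V E w t l"
      using l by (auto simp: F_def fractional_clique_cover_def)
    show "?tot l \<le> ?tot l'" if l': "fractional_clique_cover V E w t l'" for l'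
    \<comment> \<open>A cover costlier than \<open>l0\<close> may leave the box, but it is already
      beaten by \<open>l0\<close>, whose truncation lies in the box.\<close>
    proof (cases "?tot l' \<le> ?tot l0")
      case True
      then show ?thesis using min[OF cut[OF l' True]] by simp
    next
      case False
      then show ?thesis using min[OF cut[OF l0]] by simp
    qed
  qed
qed

theorem theorem5:
  fixes V :: "'a set" and E :: "'a set set"
    and w :: "'a \<Rightarrow> real" and wE :: "'a set \<Rightarrow> real"
  assumes "simple_graph V E"
    and "\<And>i. i \<in> V \<Longrightarrow> 0 \<le> w i"
    and "\<And>i j. {i, j} \<in> E \<Longrightarrow> min (w i) (w j) \<le> wE {i, j}"
  shows "handelman_bound V E w wE 2 = ereal (fractional_clique_cover_number V E w 2)"
proof -
  let ?tot = "\<lambda>l. \<Sum>C\<in>bounded_cliques V E 2. l C :: real"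
  obtain l where l: "fractional_clique_cover V E w 2 l"
    and min: "\<And>l'. fractional_clique_cover V E w 2 l' \<Longrightarrow> ?tot l \<le> ?tot l'"
  proof (rule fractional_clique_cover_min_exists[where t = 2 and w = w])
    show "simple_graph V E" by (rule assms(1))
    show "0 \<le> w i" if "i \<in> V" for i by (rule assms(2)[OF that])
  qed auto
  have "fractional_clique_cover_number V E w 2 = ?tot l"
    unfolding fractional_clique_cover_number_def
    using l min by (intro Least_equality) auto
  moreover have "handelman_bound V E w wE 2 = ereal (?tot l)"
    unfolding handelman_bound_def
  proof (rule antisym)
    show "Inf {ereal r | r. PConst r - graph_poly V E w wE \<in> handelman_set V 2} \<le> ereal (?tot l)"
      using handelman_of_cover[OF assms(1,3) l] by (intro Inf_lower) auto
    show "ereal (?tot l) \<le> Inf {ereal r | r. PConst r - graph_poly V E w wE \<in> handelman_set V 2}"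
    proof (rule Inf_greatest)
      fix y assume "y \<in> {ereal r | r. PConst r - graph_poly V E w wE \<in> handelman_set V 2}"
      then obtain r where r: "y = ereal r" "PConst r - graph_poly V E w wE \<in> handelman_set V 2"
        by blast
      obtain l' where "fractional_clique_cover V E w 2 l'" "?tot l' \<le> r"
        using cover_of_handelman[OF assms(1,2) r(2)] by blast
      then show "ereal (?tot l) \<le> y" using min[of l'] r(1) by simp
    qed
  qed
  ultimately show ?thesis by simp
qed

end
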